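(* Let $k,d,d'$ be integers with either $2\leq k<d\leq d'$ or $2\leq k=d<d'$. Then the following special unextendible entangled bases with Schmidt number $k$ (SUEB$k$s) exist in $\mathbb{C}^{d}\otimes\mathbb{C}^{d'}$: (1) If $k\mid d$, then for every $i\in\{1,\dots,k-1\}$ with $d'-i\geq k$, there is a $d(d'-i)$-number SUEB$k$. (2) If $k\nmid d$, write $d=sk+r$ with $0<r<k$; then for every $t\in\{0,1,\dots,k-r-1\}$ with $d'-t\geq k$, there is an $sk(d'-t)$-number SUEB$k$. (3) If $k\mid d'$, then for every $i\in\{1,\dots,k-1\}$ with $d-i\geq k$, there is a $d'(d-i)$-number SUEB$k$. (4) If $k\nmid d'$, write $d'=sk+r$ with $0<r<k$; then for every $t\in\{0,1,\dots,k-r-1\}$ with $d-t\geq k$, there is an $sk(d-t)$-number SUEB$k$.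
   Context: A pure state $|\psi\rangle\in\mathbb{C}^{d}\otimes\mathbb{C}^{d'}$ is a special entangled state with Schmidt number $k$ if its Schmidt decomposition is $|\psi\rangle=\sum_{i=0}^{k-1}\frac{1}{\sqrt{k}}|i\rangle|i'\rangle$ with $\{|i\rangle\}$, $\{|i'\rangle\}$ orthonormal sets in $\mathbb{C}^d$, $\mathbb{C}^{d'}$ respectively (i.e. Schmidt rank $k$ and all nonzero Schmidt coefficients equal to $1/\sqrt{k}$). A set $\{|\psi_i\rangle: i=1,\dots,n\}$ with $n<dd'$ of special entangled states with Schmidt number $k$ in $\mathbb{C}^{d}\otimes\mathbb{C}^{d'}$ is an $n$-number SUEB$k$ if (i) $\langle\psi_i|\psi_j\rangle=\delta_{ij}$, and (ii) any state $|\phi\rangle$ with $\langle\psi_i|\phi\rangle=0$ for all $i$ is not a special entangled state with Schmidt number $k$. *)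

theory Defs
  imports Complex_Main "Jordan_Normal_Form.Matrix" "Jordan_Normal_Form.Conjugate"
begin

text \<open>
  \<open>\<complex>\<^sup>d \<otimes> \<complex>\<^sup>e\<close> is identified with \<open>\<complex>\<^sup>d\<^sup>e\<close> through the basis
  \<open>|i\<rangle>|j\<rangle> \<mapsto> |i e + j\<rangle>\<close> (Kronecker product).
\<close>

definition tensor_vec :: "complex vec \<Rightarrow> complex vec \<Rightarrow> complex vec" where
  "tensor_vec u v = vec (dim_vec u * dim_vec v)
     (\<lambda>x. u $ (x div dim_vec v) * v $ (x mod dim_vec v))"

text \<open>The physics bracket \<open>\<langle>u|v\<rangle>\<close> is antilinear in its first argument, whereas
  \<open>\<bullet>c\<close> is antilinear in its second one.\<close>

definition braket :: "complex vec \<Rightarrow> complex vec \<Rightarrow> complex" where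
  "braket u v = v \<bullet>c u"

definition orthonormal_family :: "nat \<Rightarrow> nat set \<Rightarrow> (nat \<Rightarrow> complex vec) \<Rightarrow> bool" where
  "orthonormal_family n I u \<longleftrightarrow>
     (\<forall>i\<in>I. u i \<in> carrier_vec n) \<and>
     (\<forall>i\<in>I. \<forall>j\<in>I. braket (u i) (u j) = (if i = j then 1 else 0))"

definition pure_state :: "nat \<Rightarrow> complex vec \<Rightarrow> bool" where
  "pure_state n \<phi> \<longleftrightarrow> \<phi> \<in> carrier_vec n \<and> braket \<phi> \<phi> = 1"

definition special_entangled :: "nat \<Rightarrow> nat \<Rightarrow> nat \<Rightarrow> complex vec \<Rightarrow> bool" where
  "special_entangled d d' k \<psi> \<longleftrightarrow>
     pure_state (d * d') \<psi> \<and>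
     (\<exists>u v. orthonormal_family d {0..<k} u \<and> orthonormal_family d' {0..<k} v \<and>
        \<psi> = finsum_vec TYPE(complex) (d * d')
              (\<lambda>i. complex_of_real (1 / sqrt (real k)) \<cdot>\<^sub>v tensor_vec (u i) (v i)) {0..<k})"

definition SUEB :: "nat \<Rightarrow> nat \<Rightarrow> nat \<Rightarrow> nat \<Rightarrow> (nat \<Rightarrow> complex vec) \<Rightarrow> bool" where
  "SUEB d d' k n \<psi> \<longleftrightarrow>
     n < d * d' \<and>
     (\<forall>i\<in>{1..n}. special_entangled d d' k (\<psi> i)) \<and>
     (\<forall>i\<in>{1..n}. \<forall>j\<in>{1..n}. braket (\<psi> i) (\<psi> j) = (if i = j then 1 else 0)) \<and>
     (\<forall>\<phi>. pure_state (d * d') \<phi> \<and> (\<forall>i\<in>{1..n}. braket (\<psi> i) \<phi> = 0) \<longrightarrow>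
        \<not> special_entangled d d' k \<phi>)"

end

theory Submission
  imports Defs "Jordan_Normal_Form.Determinant" "HOL-Number_Theory.Cong"
begin

text \<open>
  A state in \<open>\<complex>\<^sup>d \<otimes> \<complex>\<^sup>e\<close> is viewed as its \<open>d \<times> e\<close> coefficient matrix. For \<open>s k \<le> d\<close> and
  \<open>k \<le> q \<le> e\<close> the states
  \<open>(1/\<surd>k) \<Sum>\<^sub>l \<omega>\<^sup>m\<^sup>l |a k + l\<rangle> |(l + j) mod q\<rangle>\<close>, with \<open>\<omega>\<close> a primitive \<open>k\<close>-th root of unity,
  \<open>a < s\<close>, \<open>m < k\<close> and \<open>j < q\<close>, form an orthonormal basis of the matrices supported on the
  first \<open>s k\<close> rows and first \<open>q\<close> columns. A matrix orthogonal to all of them is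
  supported on the other \<open>d - s k\<close> rows and \<open>e - q\<close> columns, so its rank is at most
  \<open>(d - s k) + (e - q)\<close>, which is less than \<open>k\<close> in each of the four cases (the last two being
  the transposes of the first two).
\<close>

section \<open>Coefficient matrices and exchange of the two tensor factors\<close>

definition mat_inner :: "nat \<Rightarrow> nat \<Rightarrow> (nat \<Rightarrow> nat \<Rightarrow> complex) \<Rightarrow> (nat \<Rightarrow> nat \<Rightarrow> complex) \<Rightarrow> complex" where
  "mat_inner d e M N = (\<Sum>x<d. \<Sum>y<e. cnj (M x y) * N x y)"

definition orthonormal_funs :: "nat \<Rightarrow> nat \<Rightarrow> (nat \<Rightarrow> nat \<Rightarrow> complex) \<Rightarrow> bool" where
  "orthonormal_funs n k u \<longleftrightarrow>
     (\<forall>a<k. \<forall>b<k. (\<Sum>x<n. cnj (u a x) * u b x) = (if a = b then 1 else 0))"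

text \<open>For \<open>k > 0\<close> these are the rank-\<open>k\<close> partial isometries scaled
  by \<open>1 / sqrt k\<close>. The equation is restricted to \<open>x < d\<close> and
  \<open>y < e\<close> because matrices are total functions here.\<close>

definition special_mat :: "nat \<Rightarrow> nat \<Rightarrow> nat \<Rightarrow> (nat \<Rightarrow> nat \<Rightarrow> complex) \<Rightarrow> bool" where
  "special_mat d e k M \<longleftrightarrow>
     (\<exists>u v. orthonormal_funs d k u \<and> orthonormal_funs e k v \<and>
        (\<forall>x<d. \<forall>y<e. M x y = complex_of_real (1 / sqrt (real k)) * (\<Sum>l<k. u l x * v l y)))"

text \<open>The index type is left open so that triples can serve as indices; the numbering by
  \<open>{1..n}\<close> and the bound \<open>n < d * d'\<close> of \<open>SUEB\<close> are supplied
  later.\<close>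

definition unextendible_mats ::
  "nat \<Rightarrow> nat \<Rightarrow> nat \<Rightarrow> 'i set \<Rightarrow> ('i \<Rightarrow> nat \<Rightarrow> nat \<Rightarrow> complex) \<Rightarrow> bool" where
  "unextendible_mats d e k I M \<longleftrightarrow>
     (\<forall>i\<in>I. special_mat d e k (M i)) \<and>
     (\<forall>i\<in>I. \<forall>j\<in>I. mat_inner d e (M i) (M j) = (if i = j then 1 else 0)) \<and>
     (\<forall>\<Phi>. special_mat d e k \<Phi> \<longrightarrow> (\<exists>i\<in>I. mat_inner d e (M i) \<Phi> \<noteq> 0))"

lemma mat_inner_transpose:
  "mat_inner e d (\<lambda>x y. M y x) (\<lambda>x y. N y x) = mat_inner d e M N"
  unfolding mat_inner_def by (rule sum.swap)

lemma special_mat_transpose: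
  assumes "special_mat d e k M"
  shows "special_mat e d k (\<lambda>x y. M y x)"
proof -
  obtain u v where "orthonormal_funs d k u" "orthonormal_funs e k v"
    and "\<forall>x<d. \<forall>y<e. M x y = complex_of_real (1 / sqrt (real k)) * (\<Sum>l<k. u l x * v l y)"
    using assms unfolding special_mat_def by blast
  then show ?thesis
    unfolding special_mat_def by (intro exI[of _ v] exI[of _ u]) (simp add: mult.commute)
qed

text \<open>Transposition preserves both \<open>mat_inner\<close> and \<open>special_mat\<close>.
  Cases (3) and (4) follow from (1) and (2) through this symmetry.\<close>

lemma unextendible_mats_transpose:
  assumes "unextendible_mats d e k I M"
  shows "unextendible_mats e d k I (\<lambda>i x y. M i y x)"
  unfolding unextendible_mats_def
proof (intro conjI ballI allI impI)
  fix i assume "i \<in> I"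
  then show "special_mat e d k (\<lambda>x y. M i y x)"
    using assms special_mat_transpose unfolding unextendible_mats_def by blast
next
  fix i j assume "i \<in> I" "j \<in> I"
  then show "mat_inner e d (\<lambda>x y. M i y x) (\<lambda>x y. M j y x) = (if i = j then 1 else 0)"
    using assms mat_inner_transpose[of e d "M i" "M j"] unfolding unextendible_mats_def by metis
next
  fix \<Phi> assume "special_mat e d k \<Phi>"
  then have "special_mat d e k (\<lambda>x y. \<Phi> y x)"
    by (rule special_mat_transpose)
  then obtain i where "i \<in> I" "mat_inner d e (M i) (\<lambda>x y. \<Phi> y x) \<noteq> 0"
    using assms unfolding unextendible_mats_def by blast
  then show "\<exists>i\<in>I. mat_inner e d (\<lambda>x y. M i y x) \<Phi> \<noteq> 0"
    using mat_inner_transpose[of d e "\<lambda>x y. M i y x" \<Phi>] by auto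
qed

section \<open>Translation between vectors and coefficient matrices\<close>

lemma sum_lessThan_mult:
  fixes f :: "nat \<Rightarrow> 'a::comm_monoid_add"
  shows "(\<Sum>z<d * e. f z) = (\<Sum>x<d. \<Sum>y<e. f (x * e + y))"
proof (induction d)
  case (Suc d)
  have "{..<Suc d * e} = {..<d * e} \<union> {d * e..<d * e + e}"
    by auto
  then have "(\<Sum>z<Suc d * e. f z) = (\<Sum>z<d * e. f z) + (\<Sum>z=d * e..<d * e + e. f z)"
    by (simp add: sum.union_disjoint ivl_disj_int)
  also have "(\<Sum>z=d * e..<d * e + e. f z) = (\<Sum>y<e. f (d * e + y))"
    using sum.shift_bounds_nat_ivl[of f 0 "d * e" e]
    by (simp add: atLeast0LessThan add.commute)
  finally show ?case
    using Suc by simp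
qed simp

lemma index_pair_less:
  assumes "x < d" "y < (e::nat)"
  shows "x * e + y < d * e"
proof -
  have "x * e + y < Suc x * e"
    using assms by simp
  also have "\<dots> \<le> d * e"
    using assms by (intro mult_right_mono) auto
  finally show ?thesis .
qed

lemma braket_sum: "dim_vec u = n \<Longrightarrow> braket u v = (\<Sum>x<n. cnj (u $ x) * v $ x)"
  unfolding braket_def scalar_prod_def
  by (auto simp: atLeast0LessThan mult.commute intro!: sum.cong)

lemma braket_eq_mat_inner:
  assumes "\<psi> \<in> carrier_vec (d * e)"
  shows "braket \<psi> \<phi> = mat_inner d e (\<lambda>x y. \<psi> $ (x * e + y)) (\<lambda>x y. \<phi> $ (x * e + y))"
  using assms by (simp add: braket_sum[of _ "d * e"] sum_lessThan_mult mat_inner_def)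

lemma orthonormal_family_iff:
  "orthonormal_family n {0..<k} u \<longleftrightarrow>
     (\<forall>a<k. u a \<in> carrier_vec n) \<and> orthonormal_funs n k (\<lambda>a x. u a $ x)"
  unfolding orthonormal_family_def orthonormal_funs_def
  by (auto simp: braket_sum[of _ n])

lemma special_entangled_imp_special_mat:
  assumes "special_entangled d e k \<psi>"
  shows "special_mat d e k (\<lambda>x y. \<psi> $ (x * e + y))"
proof -
  let ?c = "complex_of_real (1 / sqrt (real k))"
  obtain u v where u: "orthonormal_family d {0..<k} u" and v: "orthonormal_family e {0..<k} v"
    and \<psi>: "\<psi> = finsum_vec TYPE(complex) (d * e) (\<lambda>i. ?c \<cdot>\<^sub>v tensor_vec (u i) (v i)) {0..<k}"
    using assms unfolding special_entangled_def by blast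
  have dims: "dim_vec (u l) = d" "dim_vec (v l) = e" if "l < k" for l
    using u v that by (auto simp: orthonormal_family_iff)
  have carr: "(\<lambda>i. ?c \<cdot>\<^sub>v tensor_vec (u i) (v i)) \<in> {0..<k} \<rightarrow> carrier_vec (d * e)"
    by (rule Pi_I, rule carrier_vecI) (simp add: tensor_vec_def dims)
  have "\<psi> $ (x * e + y) = ?c * (\<Sum>l<k. u l $ x * v l $ y)" if "x < d" "y < e" for x y
  proof -
    have "\<psi> $ (x * e + y) = (\<Sum>l\<in>{0..<k}. (?c \<cdot>\<^sub>v tensor_vec (u l) (v l)) $ (x * e + y))"
      unfolding \<psi> by (rule index_finsum_vec[OF _ index_pair_less[OF that] carr]) simp
    also have "\<dots> = (\<Sum>l\<in>{0..<k}. ?c * (u l $ x * v l $ y))"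
      using index_pair_less[OF that] that
      by (intro sum.cong) (auto simp: tensor_vec_def dims)
    finally show ?thesis
      by (simp add: sum_distrib_left atLeast0LessThan)
  qed
  then show ?thesis
    unfolding special_mat_def using u v
    by (intro exI[of _ "\<lambda>a x. u a $ x"] exI[of _ "\<lambda>a x. v a $ x"])
      (auto simp: orthonormal_family_iff)
qed

text \<open>Row-major vectorisation, inverse on the relevant index ranges to reading off the matrix
  \<open>\<lambda>x y. \<psi> $ (x * e + y)\<close>.\<close>

definition vec_of_fun :: "nat \<Rightarrow> nat \<Rightarrow> (nat \<Rightarrow> nat \<Rightarrow> complex) \<Rightarrow> complex vec" where
  "vec_of_fun d e M = vec (d * e) (\<lambda>z. M (z div e) (z mod e))"

lemma vec_of_fun_index:
  "x < d \<Longrightarrow> y < e \<Longrightarrow> vec_of_fun d e M $ (x * e + y) = M x y"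
  using index_pair_less[of x d y e] by (simp add: vec_of_fun_def)

lemma vec_of_fun_carrier: "vec_of_fun d e M \<in> carrier_vec (d * e)"
  by (simp add: vec_of_fun_def)

lemma braket_vec_of_fun:
  "braket (vec_of_fun d e M) \<phi> = mat_inner d e M (\<lambda>x y. \<phi> $ (x * e + y))"
  unfolding braket_eq_mat_inner[OF vec_of_fun_carrier]
  by (simp add: mat_inner_def vec_of_fun_index)

lemma braket_vec_of_fun2:
  "braket (vec_of_fun d e M) (vec_of_fun d e N) = mat_inner d e M N"
  unfolding braket_vec_of_fun by (simp add: mat_inner_def vec_of_fun_index)

text \<open>The norm is a hypothesis because \<open>special_entangled\<close> asks for a pure state;
  in the application it is the diagonal case of orthonormality.\<close>

lemma special_entangled_vec_of_fun:
  assumes "special_mat d e k M" and norm: "mat_inner d e M M = 1"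
  shows "special_entangled d e k (vec_of_fun d e M)"
proof -
  let ?c = "complex_of_real (1 / sqrt (real k))"
  obtain u v where u: "orthonormal_funs d k u" and v: "orthonormal_funs e k v"
    and M: "\<forall>x<d. \<forall>y<e. M x y = ?c * (\<Sum>l<k. u l x * v l y)"
    using assms(1) unfolding special_mat_def by blast
  let ?u = "\<lambda>l. vec d (u l)" and ?v = "\<lambda>l. vec e (v l)"
  have u': "orthonormal_family d {0..<k} ?u" and v': "orthonormal_family e {0..<k} ?v"
    using u v by (auto simp: orthonormal_family_iff orthonormal_funs_def)
  have carr: "(\<lambda>i. ?c \<cdot>\<^sub>v tensor_vec (?u i) (?v i)) \<in> {0..<k} \<rightarrow> carrier_vec (d * e)"
    by (rule Pi_I, rule carrier_vecI) (simp add: tensor_vec_def)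
  have "vec_of_fun d e M
      = finsum_vec TYPE(complex) (d * e) (\<lambda>i. ?c \<cdot>\<^sub>v tensor_vec (?u i) (?v i)) {0..<k}"
    (is "_ = ?F")
  proof (rule eq_vecI)
    show "dim_vec (vec_of_fun d e M) = dim_vec ?F"
      using finsum_vec_closed[OF carr] by (simp add: vec_of_fun_def)
    fix z assume "z < dim_vec ?F"
    then have z: "z < d * e"
      using finsum_vec_closed[OF carr] by simp
    then have "z div e < d" "z mod e < e"
      by (auto simp: less_mult_imp_div_less intro!: mod_less_divisor gr0I)
    then show "vec_of_fun d e M $ z = ?F $ z"
      unfolding index_finsum_vec[OF finite_atLeastLessThan z carr]
      using M z by (simp add: vec_of_fun_def tensor_vec_def sum_distrib_left atLeast0LessThan)
  qed
  moreover have "pure_state (d * e) (vec_of_fun d e M)"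
    using norm by (simp add: pure_state_def vec_of_fun_carrier braket_vec_of_fun2)
  ultimately show ?thesis
    unfolding special_entangled_def using u' v' by blast
qed

lemma SUEB_of_unextendible_mats:
  assumes "unextendible_mats d e k I M" "finite I" "card I < d * e"
  shows "\<exists>\<psi>. SUEB d e k (card I) \<psi>"
proof -
  obtain h where h: "bij_betw h {1..card I} I"
    using ex_bij_betw_nat_finite_1[OF assms(2)] by blast
  have hI: "h i \<in> I" if "i \<in> {1..card I}" for i
    using h that by (rule bij_betwE[rule_format])
  have inj: "h i = h j \<longleftrightarrow> i = j" if "i \<in> {1..card I}" "j \<in> {1..card I}" for i j
    using inj_on_eq_iff[OF bij_betw_imp_inj_on[OF h] that] .
  have "SUEB d e k (card I) (\<lambda>i. vec_of_fun d e (M (h i)))"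
    unfolding SUEB_def
  proof (intro conjI ballI allI impI)
    fix i assume "i \<in> {1..card I}"
    then show "special_entangled d e k (vec_of_fun d e (M (h i)))"
      using assms(1) hI[of i]
      by (intro special_entangled_vec_of_fun) (auto simp: unextendible_mats_def)
  next
    fix i j assume "i \<in> {1..card I}" "j \<in> {1..card I}"
    then show "braket (vec_of_fun d e (M (h i))) (vec_of_fun d e (M (h j))) = (if i = j then 1 else 0)"
      using assms(1) hI inj by (simp add: unextendible_mats_def braket_vec_of_fun2)
  next
    fix \<phi>
    assume *: "pure_state (d * e) \<phi> \<and> (\<forall>i\<in>{1..card I}. braket (vec_of_fun d e (M (h i))) \<phi> = 0)"
    show "\<not> special_entangled d e k \<phi>"
    proof
      assume "special_entangled d e k \<phi>"
      from special_entangled_imp_special_mat[OF this]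
      obtain i where "i \<in> I" "mat_inner d e (M i) (\<lambda>x y. \<phi> $ (x * e + y)) \<noteq> 0"
        using assms(1) unfolding unextendible_mats_def by blast
      moreover from \<open>i \<in> I\<close> have "i \<in> h ` {1..card I}"
        by (simp only: bij_betw_imp_surj_on[OF h])
      then obtain j where "j \<in> {1..card I}" "i = h j"
        by (rule imageE)
      ultimately show False
        using * by (simp only: braket_vec_of_fun)
    qed
  qed (use assms in auto)
  then show ?thesis by blast
qed

section \<open>Special matrices cannot vanish on a large leading block\<close>

text \<open>The system is completed to a square one whose row \<open>m\<close> is zero. Its
  determinant vanishes, and any nonzero kernel vector solves the first \<open>m\<close>
  equations.\<close>

lemma underdetermined_homogeneous_solution:
  fixes f :: "nat \<Rightarrow> nat \<Rightarrow> 'a::field"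
  assumes "m < k"
  shows "\<exists>c. (\<exists>l<k. c l \<noteq> 0) \<and> (\<forall>i<m. (\<Sum>l<k. f i l * c l) = 0)"
proof -
  let ?A = "mat\<^sub>r k k (\<lambda>i. if i = m then 0\<^sub>v k else vec k (f i))"
  have "det ?A = 0"
    using assms by (intro det_row_0) auto
  then obtain v where v: "v \<in> carrier_vec k" "v \<noteq> 0\<^sub>v k" "?A *\<^sub>v v = 0\<^sub>v k"
    using det_0_iff_vec_prod_zero_field[of ?A k] by auto
  have "\<exists>l<k. v $ l \<noteq> 0"
    using v(1,2) by (metis carrier_vecD eq_vecI index_zero_vec)
  moreover have "(\<Sum>l<k. f i l * v $ l) = 0" if "i < m" for i
  proof -
    have "(?A *\<^sub>v v) $ i = 0"
      using v(3) that assms by simp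
    then show ?thesis
      using that assms v(1) by (simp add: scalar_prod_def atLeast0LessThan)
  qed
  ultimately show ?thesis by (intro exI[of _ "\<lambda>l. v $ l"]) blast
qed

text \<open>Pairing the vanishing combination with \<open>u a\<close> leaves only the coefficient
  \<open>c a\<close>.\<close>

lemma orthonormal_funs_indep:
  assumes u: "orthonormal_funs n k u" and "\<And>x. x < n \<Longrightarrow> (\<Sum>l<k. u l x * c l) = 0" "a < k"
  shows "c a = 0"
proof -
  have "0 = (\<Sum>x<n. cnj (u a x) * (\<Sum>l<k. u l x * c l))"
    using assms(2) by simp
  also have "\<dots> = (\<Sum>l<k. (\<Sum>x<n. cnj (u a x) * u l x) * c l)"
    by (simp add: sum_distrib_left sum_distrib_right mult.assoc) (rule sum.swap)
  also have "\<dots> = (\<Sum>l<k. if l = a then c l else 0)"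
    using u \<open>a < k\<close> by (intro sum.cong) (auto simp: orthonormal_funs_def)
  also have "\<dots> = c a"
    using \<open>a < k\<close> by simp
  finally show ?thesis by simp
qed

text \<open>A kernel argument replaces the rank bound: pick \<open>c \<noteq> 0\<close> such that \<open>w = \<Sum>\<^sub>l c\<^sub>l \<cdot> cnj v\<^sub>l\<close>
  vanishes on the last \<open>e - q\<close> columns and \<open>\<Sum>\<^sub>l c\<^sub>l u\<^sub>l\<close>, a multiple of \<open>M w\<close>, vanishes on the
  last \<open>d - p\<close> rows. If the leading block of \<open>M\<close> were zero, then \<open>M w\<close> would also vanish on the
  first \<open>p\<close> rows, against the independence of the \<open>u\<^sub>l\<close>.\<close>

lemma special_mat_nonzero_entry:
  assumes "special_mat d e k M" "p \<le> d" "q \<le> e" "(d - p) + (e - q) < k"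
  shows "\<exists>x<p. \<exists>y<q. M x y \<noteq> 0"
proof (rule ccontr)
  assume "\<not> ?thesis"
  then have zero: "M x y = 0" if "x < p" "y < q" for x y
    using that by blast
  let ?c = "complex_of_real (1 / sqrt (real k))"
  have "k > 0" using assms(4) by simp
  then have c0: "?c \<noteq> 0" by simp
  obtain u v where u: "orthonormal_funs d k u" and v: "orthonormal_funs e k v"
    and M: "\<forall>x<d. \<forall>y<e. M x y = ?c * (\<Sum>l<k. u l x * v l y)"
    using assms(1) unfolding special_mat_def by blast
  \<comment> \<open>Equations \<open>0\<close> to \<open>d - p - 1\<close> belong to the rows from
    \<open>p\<close> on; equation \<open>(d - p) + (y - q)\<close> belongs to column
    \<open>y\<close>.\<close>
  let ?f = "\<lambda>i l. if i < d - p then u l (p + i) else cnj (v l (q + (i - (d - p))))"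
  obtain c where c: "\<exists>l<k. c l \<noteq> 0"
    and sol: "\<forall>i<(d - p) + (e - q). (\<Sum>l<k. ?f i l * c l) = 0"
    using underdetermined_homogeneous_solution[OF assms(4), of ?f] by blast
  define w where "w y = (\<Sum>l<k. cnj (v l y) * c l)" for y
  have w0: "w y = 0" if "q \<le> y" "y < e" for y
  proof -
    have "(d - p) + (y - q) < (d - p) + (e - q)"
      using that by simp
    from sol[rule_format, OF this] show ?thesis
      unfolding w_def by (simp only: not_add_less1 if_False diff_add_inverse le_add_diff_inverse[OF that(1)])
  qed
  \<comment> \<open>The matrix acts on \<open>w\<close> bilinearly, so the conjugates built into
    \<open>w\<close> turn the sums over \<open>y\<close> into Hermitian products of the
    \<open>v l\<close>, which are orthonormal.\<close>
  have Mw: "(\<Sum>y<e. M x y * w y) = ?c * (\<Sum>l<k. u l x * c l)" if "x < d" for x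
  proof -
    have "(\<Sum>y<e. M x y * w y) = (\<Sum>y<e. \<Sum>l<k. \<Sum>b<k. ?c * u l x * c b * (cnj (v b y) * v l y))"
      using M that by (intro sum.cong refl)
        (simp add: w_def sum_product sum_distrib_left sum_distrib_right sum_divide_distrib mult_ac)
    also have "\<dots> = (\<Sum>l<k. \<Sum>b<k. ?c * u l x * c b * (\<Sum>y<e. cnj (v b y) * v l y))"
      unfolding sum_distrib_left sum.swap[of _ "{..<k}" "{..<e}"] ..
    also have "\<dots> = (\<Sum>l<k. \<Sum>b<k. if b = l then ?c * u l x * c b else 0)"
      using v by (intro sum.cong refl) (auto simp: orthonormal_funs_def)
    also have "\<dots> = ?c * (\<Sum>l<k. u l x * c l)"
      by (simp add: sum_distrib_left mult_ac)
    finally show ?thesis .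
  qed
  have "(\<Sum>l<k. u l x * c l) = 0" if "x < d" for x
  proof (cases "x < p")
    case True
    have "(\<Sum>y<e. M x y * w y) = 0"
      using zero[OF True] w0 by (intro sum.neutral) (metis lessThan_iff mult_eq_0_iff not_le)
    then show ?thesis
      using Mw[OF that] c0 by simp
  next
    case False
    then show ?thesis
      using sol[rule_format, of "x - p"] that by (simp add: diff_less_mono)
  qed
  then show False
    using orthonormal_funs_indep[OF u] c by blast
qed

section \<open>Roots of unity and the Fourier matrices\<close>

text \<open>The summands are powers of \<open>cnj (\<omega> ^ a) * \<omega> ^ b\<close>, a
  \<open>k\<close>-th root of unity. For \<open>a \<noteq> b\<close> it differs from 1, so the
  geometric sum vanishes.\<close>

lemma roots_unity_orthogonal:
  fixes k a b :: nat
  assumes "a < k" "b < k"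
  defines "\<omega> \<equiv> cis (2 * pi / real k)"
  shows "(\<Sum>l<k. cnj (\<omega> ^ (a * l)) * \<omega> ^ (b * l)) = (if a = b then of_nat k else 0)"
proof -
  have k: "k > 0" using assms by simp
  have pow: "\<omega> ^ n = cis (2 * pi * real n / real k)" for n
    by (simp add: \<omega>_def DeMoivre mult_ac)
  have one: "cnj (\<omega> ^ n) * \<omega> ^ n = 1" for n
    by (simp add: pow cis_cnj cis_mult)
  let ?z = "cnj (\<omega> ^ a) * \<omega> ^ b"
  have \<omega>k: "\<omega> ^ k = 1"
    using k by (simp add: pow)
  have zk: "?z ^ k = 1"
  proof -
    have "?z ^ k = cnj ((\<omega> ^ k) ^ a) * (\<omega> ^ k) ^ b"
      by (simp add: power_mult_distrib power_mult[symmetric] mult.commute flip: complex_cnj_power)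
    then show ?thesis by (simp add: \<omega>k)
  qed
  have z: "cnj (\<omega> ^ (a * l)) * \<omega> ^ (b * l) = ?z ^ l" for l
    by (simp add: power_mult_distrib power_mult)
  show ?thesis
  proof (cases "a = b")
    case True
    then show ?thesis by (simp add: one del: complex_cnj_power)
  next
    case False
    \<comment> \<open>Since \<open>\<omega> ^ a\<close> has modulus 1, the value 1 would force
      \<open>\<omega> ^ b = \<omega> ^ a\<close>, although the exponents below \<open>k\<close> give
      distinct roots.\<close>
    have "?z \<noteq> 1"
    proof
      assume "?z = 1"
      then have "\<omega> ^ a * (cnj (\<omega> ^ a) * \<omega> ^ b) = \<omega> ^ a"
        by simp
      then have "\<omega> ^ b = \<omega> ^ a"
        using one[of a] by (metis mult.assoc mult.commute mult_1)
      then have "cis (2 * pi * real b / real k) = cis (2 * pi * real a / real k)"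
        by (simp only: pow)
      then show False
        using bij_betw_roots_unity[OF k] False assms(1,2)
        by (auto simp: bij_betw_def inj_on_def)
    qed
    then have "(\<Sum>l<k. ?z ^ l) = 0"
      using zk by (subst geometric_sum) auto
    then show ?thesis
      using False by (simp only: z if_False)
  qed
qed

lemma shift_mod_eq_iff:
  fixes q :: nat
  assumes "i < q" "j < q"
  shows "(l + i) mod q = (l + j) mod q \<longleftrightarrow> i = j"
  using assms by (metis cong_add_lcancel_nat cong_def mod_less)

text \<open>The \<open>k\<close> nonzero entries lie, when \<open>k \<le> q\<close>, on a diagonal
  of the row block \<open>a\<close> that starts in column \<open>j\<close> and wraps around modulo
  \<open>q\<close>. The sum of products is kept so that the factors for \<open>special_mat\<close>
  can be read off.\<close>

definition fourier_mat :: "nat \<Rightarrow> nat \<Rightarrow> nat \<times> nat \<times> nat \<Rightarrow> nat \<Rightarrow> nat \<Rightarrow> complex" where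
  "fourier_mat k q = (\<lambda>(a, m, j) x y. complex_of_real (1 / sqrt (real k)) *
     (\<Sum>l<k. (if x = a * k + l then cis (2 * pi / real k) ^ (m * l) else 0) *
            (if y = (l + j) mod q then 1 else 0)))"

text \<open>The row factors are distinct unit vectors times phases. The column factors are unit
  vectors, distinct because \<open>k \<le> q\<close> makes \<open>l \<mapsto> (l + j) mod q\<close>
  injective on \<open>{..<k}\<close>.\<close>

lemma special_mat_fourier_mat:
  assumes "a < s" "m < k" "j < q" "s * k \<le> d" "k \<le> q" "q \<le> e"
  shows "special_mat d e k (fourier_mat k q (a, m, j))"
proof -
  let ?\<omega> = "cis (2 * pi / real k)"
  have row: "a * k + l < d" if "l < k" for l
    using index_pair_less[OF assms(1) that] assms(4) by simp
  have col: "(l + j) mod q < e" for l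
    using assms by (metis less_le_trans mod_less_divisor gr0I not_less0)
  have inj: "(b + j) mod q = (l + j) mod q \<longleftrightarrow> b = l" if "b < k" "l < k" for b l
    using shift_mod_eq_iff[of b q l j] that assms(5) by (simp add: add.commute)
  have unit: "cnj (?\<omega> ^ n) * ?\<omega> ^ n = 1" for n
    by (simp add: DeMoivre cis_cnj cis_mult)
  have "orthonormal_funs d k (\<lambda>l x. if x = a * k + l then ?\<omega> ^ (m * l) else 0)"
    unfolding orthonormal_funs_def
  proof (intro allI impI)
    fix b l assume "b < k" "l < k"
    have "(\<Sum>x<d. cnj (if x = a * k + b then ?\<omega> ^ (m * b) else 0) *
              (if x = a * k + l then ?\<omega> ^ (m * l) else 0))
        = (\<Sum>x<d. if x = a * k + b then (if b = l then 1 else 0) else 0)"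
      using unit by (intro sum.cong) auto
    then show "(\<Sum>x<d. cnj (if x = a * k + b then ?\<omega> ^ (m * b) else 0) *
              (if x = a * k + l then ?\<omega> ^ (m * l) else 0)) = (if b = l then 1 else 0)"
      using row[OF \<open>b < k\<close>] by simp
  qed
  moreover have "orthonormal_funs e k (\<lambda>l y. if y = (l + j) mod q then 1 else 0)"
    unfolding orthonormal_funs_def
  proof (intro allI impI)
    fix b l assume "b < k" "l < k"
    have "(\<Sum>y<e. cnj (if y = (b + j) mod q then 1 else 0) * (if y = (l + j) mod q then 1 else 0))
        = (\<Sum>y<e. if y = (b + j) mod q then (if b = l then 1 else 0 :: complex) else 0)"
      using inj[OF \<open>b < k\<close> \<open>l < k\<close>] by (intro sum.cong) auto
    then show "(\<Sum>y<e. cnj (if y = (b + j) mod q then 1 else 0) *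
        (if y = (l + j) mod q then 1 else 0)) = (if b = l then 1 else 0 :: complex)"
      using col by simp
  qed
  ultimately show ?thesis
    unfolding special_mat_def fourier_mat_def prod.case by blast
qed

text \<open>Up to the scalar, this is the \<open>m\<close>-th discrete Fourier coefficient of
  \<open>N\<close> along the wrapped diagonal given by \<open>a\<close> and
  \<open>j\<close>.\<close>

lemma mat_inner_fourier_mat:
  assumes "a < s" "m < k" "j < q" "s * k \<le> d" "k \<le> q" "q \<le> e"
  shows "mat_inner d e (fourier_mat k q (a, m, j)) N = complex_of_real (1 / sqrt (real k)) *
    (\<Sum>l<k. cnj (cis (2 * pi / real k) ^ (m * l)) * N (a * k + l) ((l + j) mod q))"
proof -
  let ?\<omega> = "cis (2 * pi / real k)" and ?c = "complex_of_real (1 / sqrt (real k))"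
  have row: "a * k + l < d" if "l < k" for l
    using index_pair_less[OF assms(1) that] assms(4) by simp
  have col: "(l + j) mod q < e" for l
    using assms by (metis less_le_trans mod_less_divisor gr0I not_less0)
  have "mat_inner d e (fourier_mat k q (a, m, j)) N =
    (\<Sum>x<d. \<Sum>y<e. \<Sum>l<k. if x = a * k + l then if y = (l + j) mod q then
        ?c * (cnj (?\<omega> ^ (m * l)) * N x y) else 0 else 0)"
    unfolding mat_inner_def fourier_mat_def prod.case
    by (intro sum.cong refl)
      (auto simp: sum_distrib_left sum_distrib_right mult_ac intro!: sum.cong)
  also have "\<dots> = (\<Sum>l<k. \<Sum>x<d. \<Sum>y<e. if x = a * k + l then if y = (l + j) mod q then
        ?c * (cnj (?\<omega> ^ (m * l)) * N x y) else 0 else 0)"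
    unfolding sum.swap[of _ "{..<k}" "{..<e}"] sum.swap[of _ "{..<k}" "{..<d}"] ..
  also have "\<dots> = (\<Sum>l<k. \<Sum>x<d. if x = a * k + l then \<Sum>y<e. if y = (l + j) mod q then
        ?c * (cnj (?\<omega> ^ (m * l)) * N x y) else 0 else 0)"
    by (intro sum.cong refl) auto
  also have "\<dots> = (\<Sum>l<k. ?c * (cnj (?\<omega> ^ (m * l)) * N (a * k + l) ((l + j) mod q)))"
    using row col by (intro sum.cong refl) (simp del: complex_cnj_power)
  finally show ?thesis
    by (simp only: sum_distrib_left)
qed

text \<open>Wrapped diagonals with different \<open>(a, j)\<close> are disjoint: the row determines
  block and offset by division with remainder, and then the column determines the shift.\<close>

lemma fourier_mat_entry:
  assumes "l < k" "j < q" "i < q"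
  shows "fourier_mat k q (a, m, i) (b * k + l) ((l + j) mod q) =
    (if a = b \<and> i = j then complex_of_real (1 / sqrt (real k)) * cis (2 * pi / real k) ^ (m * l) else 0)"
proof -
  let ?\<omega> = "cis (2 * pi / real k)" and ?c = "complex_of_real (1 / sqrt (real k))"
  have iff: "b * k + l = a * k + n \<longleftrightarrow> b = a \<and> l = n" if "n < k" for n
  proof
    assume eq: "b * k + l = a * k + n"
    have "(b * k + l) div k = b" "(b * k + l) mod k = l" "(a * k + n) div k = a" "(a * k + n) mod k = n"
      using that \<open>l < k\<close> by auto
    then show "b = a \<and> l = n" by (metis eq)
  qed auto
  have "(\<Sum>n<k. (if b * k + l = a * k + n then ?\<omega> ^ (m * n) else 0) *
            (if (l + j) mod q = (n + i) mod q then 1 else 0))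
      = (\<Sum>n<k. if n = l then (if a = b \<and> i = j then ?\<omega> ^ (m * l) else 0) else 0)"
    using shift_mod_eq_iff[OF assms(2,3), of l] by (intro sum.cong refl) (auto simp: iff)
  then show ?thesis
    using \<open>l < k\<close> unfolding fourier_mat_def prod.case by simp
qed

text \<open>Matrices on different diagonals are orthogonal by disjoint supports, those on the same
  diagonal by orthogonality of characters. A matrix orthogonal to all of them vanishes on the
  leading block, which \<open>special_mat_nonzero_entry\<close> excludes for special
  matrices.\<close>

lemma unextendible_fourier_mats:
  assumes "s * k \<le> d" "k \<le> q" "q \<le> e" "(d - s * k) + (e - q) < k"
  shows "unextendible_mats d e k ({..<s} \<times> {..<k} \<times> {..<q}) (fourier_mat k q)"
proof -
  let ?\<omega> = "cis (2 * pi / real k)" and ?c = "complex_of_real (1 / sqrt (real k))"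
  have k: "k > 0" using assms(4) by simp
  then have c0: "?c \<noteq> 0" by simp
  have cc: "?c * ?c * of_nat k = 1"
  proof -
    have "1 / sqrt (real k) * (1 / sqrt (real k)) * real k = 1"
      using k by (simp add: field_simps)
    then show ?thesis
      by (metis of_real_1 of_real_mult of_real_of_nat_eq)
  qed
  have orth: "mat_inner d e (fourier_mat k q (a, m, j)) (fourier_mat k q (b, n, i)) =
      (if (a, m, j) = (b, n, i) then 1 else 0)"
    if "a < s" "m < k" "j < q" "b < s" "n < k" "i < q" for a m j b n i
  proof -
    have "mat_inner d e (fourier_mat k q (a, m, j)) (fourier_mat k q (b, n, i)) =
        ?c * (\<Sum>l<k. cnj (?\<omega> ^ (m * l)) * (if b = a \<and> i = j then ?c * ?\<omega> ^ (n * l) else 0))"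
      unfolding mat_inner_fourier_mat[OF that(1-3) assms(1-3)]
      using that by (simp add: fourier_mat_entry)
    also have "\<dots> = (if b = a \<and> i = j then ?c * ?c * (\<Sum>l<k. cnj (?\<omega> ^ (m * l)) * ?\<omega> ^ (n * l)) else 0)"
    proof (cases "b = a \<and> i = j")
      case True
      then show ?thesis by (simp add: sum_distrib_left mult_ac)
    next
      case False
      then show ?thesis by (simp only: if_False mult_zero_right sum.neutral_const)
    qed
    also have "\<dots> = (if (a, m, j) = (b, n, i) then 1 else 0)"
      unfolding roots_unity_orthogonal[OF that(2,5)] using cc by auto
    finally show ?thesis .
  qed
  have complete: "\<exists>i\<in>{..<s} \<times> {..<k} \<times> {..<q}. mat_inner d e (fourier_mat k q i) \<Phi> \<noteq> 0"
    if \<Phi>: "special_mat d e k \<Phi>" for \<Phi>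
  proof (rule ccontr)
    assume "\<not> ?thesis"
    then have zero: "(\<Sum>l<k. cnj (?\<omega> ^ (m * l)) * \<Phi> (a * k + l) ((l + j) mod q)) = 0"
      if "a < s" "m < k" "j < q" for a m j
      using that c0 mat_inner_fourier_mat[OF that assms(1-3), of \<Phi>] by auto
    have shifted: "\<Phi> (a * k + n) ((n + j) mod q) = 0" if "a < s" "n < k" "j < q" for a n j
    proof -
      let ?g = "\<lambda>l. \<Phi> (a * k + l) ((l + j) mod q)"
      \<comment> \<open>Fourier inversion: summing the vanishing coefficients against
        \<open>?\<omega> ^ (n * m)\<close> isolates entry \<open>n\<close> of the diagonal.\<close>
      have "0 = (\<Sum>m<k. ?\<omega> ^ (n * m) * (\<Sum>l<k. cnj (?\<omega> ^ (m * l)) * ?g l))"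
        using zero that by (simp del: complex_cnj_power)
      also have "\<dots> = (\<Sum>l<k. (\<Sum>m<k. cnj (?\<omega> ^ (l * m)) * ?\<omega> ^ (n * m)) * ?g l)"
        unfolding sum_distrib_left sum_distrib_right
        by (subst sum.swap) (simp add: mult_ac)
      also have "\<dots> = (\<Sum>l<k. if l = n then of_nat k * ?g l else 0)"
        using \<open>n < k\<close> by (intro sum.cong refl) (auto simp: roots_unity_orthogonal simp del: complex_cnj_power)
      also have "\<dots> = of_nat k * ?g n"
        using \<open>n < k\<close> by simp
      finally show ?thesis
        using k by simp
    qed
    obtain x y where xy: "x < s * k" "y < q" "\<Phi> x y \<noteq> 0"
      using special_mat_nonzero_entry[OF \<Phi> assms(1,3,4)] by blast
    let ?a = "x div k" and ?n = "x mod k"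
    have "?a < s" "?n < k" "?a * k + ?n = x"
      using xy(1) k by (auto simp: less_mult_imp_div_less)
    have "?n < q"
      using \<open>?n < k\<close> assms(2) by simp
    \<comment> \<open>This shift \<open>j\<close> makes the diagonal pass through
      \<open>(x, y)\<close>. Adding \<open>q > ?n\<close> first keeps the natural subtraction from
      truncating.\<close>
    moreover have "(?n + (y + q - ?n) mod q) mod q = y"
      using \<open>?n < q\<close> xy(2) by (simp add: mod_add_right_eq)
    ultimately show False
      using shifted[OF \<open>?a < s\<close> \<open>?n < k\<close>, of "(y + q - ?n) mod q"] xy \<open>?a * k + ?n = x\<close> by simp
  qed
  show ?thesis
    unfolding unextendible_mats_def
    using orth complete special_mat_fourier_mat[OF _ _ _ assms(1-3)] by auto
qed

section \<open>Counting and the four cases\<close>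

text \<open>With \<open>q = e - t\<close>, exactly \<open>r\<close> rows and \<open>t\<close>
  columns stay outside the block. Then \<open>r + t < k\<close> gives unextendibility, and
  \<open>0 < r + t\<close> keeps the family below the full dimension.\<close>

lemma SUEB_exists:
  assumes "s * k + r = d" "t \<le> e" "k \<le> e - t" "r + t < k" "0 < r + t" "0 < d"
  shows "\<exists>\<psi>. SUEB d e k (s * k * (e - t)) \<psi>"
    and "\<exists>\<psi>. SUEB e d k (s * k * (e - t)) \<psi>"
proof -
  let ?I = "{..<s} \<times> {..<k} \<times> {..<e - t}"
  have mats: "unextendible_mats d e k ?I (fourier_mat k (e - t))"
    using assms by (intro unextendible_fourier_mats) auto
  have card: "card ?I = s * k * (e - t)"
    by (simp add: card_cartesian_product)
  have "s * k * (e - t) < d * e"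
  \<comment> \<open>If \<open>r = 0\<close>, a column is missing since \<open>t > 0\<close>;
    otherwise a row is missing, and \<open>e > 0\<close> because
    \<open>0 < k \<le> e - t\<close>.\<close>
  proof (cases "r = 0")
    case True
    then have "e - t < e" using assms by simp
    then show ?thesis using True assms by auto
  next
    case False
    have "s * k * (e - t) \<le> s * k * e" by simp
    also have "\<dots> < d * e" using False assms by auto
    finally show ?thesis .
  qed
  then show "\<exists>\<psi>. SUEB d e k (s * k * (e - t)) \<psi>" "\<exists>\<psi>. SUEB e d k (s * k * (e - t)) \<psi>"
    using SUEB_of_unextendible_mats[OF mats]
      SUEB_of_unextendible_mats[OF unextendible_mats_transpose[OF mats]]
    unfolding card mult.commute[of e d] by auto
qed

theorem theorem3p1:
  fixes k d d' :: nat
  assumes "(2 \<le> k \<and> k < d \<and> d \<le> d') \<or> (2 \<le> k \<and> k = d \<and> d < d')"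
  shows "(k dvd d \<longrightarrow>
            (\<forall>i\<in>{1..k - 1}. d' - i \<ge> k \<longrightarrow> (\<exists>\<psi>. SUEB d d' k (d * (d' - i)) \<psi>)))
       \<and> (\<not> k dvd d \<longrightarrow>
            (\<forall>s r. d = s * k + r \<and> 0 < r \<and> r < k \<longrightarrow>
              (\<forall>t\<in>{0..k - r - 1}. d' - t \<ge> k \<longrightarrow> (\<exists>\<psi>. SUEB d d' k (s * k * (d' - t)) \<psi>))))
       \<and> (k dvd d' \<longrightarrow>
            (\<forall>i\<in>{1..k - 1}. d - i \<ge> k \<longrightarrow> (\<exists>\<psi>. SUEB d d' k (d' * (d - i)) \<psi>)))
       \<and> (\<not> k dvd d' \<longrightarrow>
            (\<forall>s r. d' = s * k + r \<and> 0 < r \<and> r < k \<longrightarrow>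
              (\<forall>t\<in>{0..k - r - 1}. d - t \<ge> k \<longrightarrow> (\<exists>\<psi>. SUEB d d' k (s * k * (d - t)) \<psi>))))"
proof (intro conjI impI ballI allI)
  have pos: "0 < k" "0 < d" "0 < d'"
    using assms by auto
  {
    fix i assume "k dvd d" "i \<in> {1..k - 1}" "d' - i \<ge> k"
    then show "\<exists>\<psi>. SUEB d d' k (d * (d' - i)) \<psi>"
      \<comment> \<open>Divisibility means \<open>r = 0\<close>, so the whole deficit is
        \<open>t = i\<close>, with \<open>0 < i < k\<close>.\<close>
      using SUEB_exists(1)[of "d div k" k 0 d i d'] pos by auto
  next
    fix s r t assume "d = s * k + r \<and> 0 < r \<and> r < k" "t \<in> {0..k - r - 1}" "d' - t \<ge> k"
    then show "\<exists>\<psi>. SUEB d d' k (s * k * (d' - t)) \<psi>"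
      \<comment> \<open>As \<open>r < k\<close>, the bound \<open>t \<le> k - r - 1\<close> is
        exactly \<open>r + t < k\<close>; strictness of the count comes from
        \<open>0 < r\<close>.\<close>
      using pos by (intro SUEB_exists(1)) auto
  next
    fix i assume "k dvd d'" "i \<in> {1..k - 1}" "d - i \<ge> k"
    then show "\<exists>\<psi>. SUEB d d' k (d' * (d - i)) \<psi>"
      using SUEB_exists(2)[of "d' div k" k 0 d' i d] pos by auto
  next
    fix s r t assume "d' = s * k + r \<and> 0 < r \<and> r < k" "t \<in> {0..k - r - 1}" "d - t \<ge> k"
    then show "\<exists>\<psi>. SUEB d d' k (s * k * (d - t)) \<psi>"
      using pos by (intro SUEB_exists(2)) auto
  }
qed

end
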